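(* Let $R$ be a p.q.-Baer $*$-ring with Conrad's partial order $\leq$ and let $a,b,c\in R$. If $a\leq c$, $b\leq c$ and $aR\cap bR=\{0\}$, then $a+b\leq c$.
   Context: A $*$-ring is an (associative) ring $R$ with an involution $x\mapsto x^*$, i.e. an additive anti-automorphism with $(x^* )^*=x$. A projection is an element $e\in R$ with $e=e^2=e^*$. A $*$-ring $R$ is a p.q.-Baer $*$-ring if for every $a\in R$ there is a projection $e\in R$ with $r_R(aR)=eR$, where $r_R(B)=\{x\in R : bx=0 \text{ for every } b\in B\}$. (Such a ring automatically has an identity element and is semiprime.) Conrad's partial order on $R$: $a\leq b$ if and only if $arb=ara$ for all $r\in R$; this is a partial order on every p.q.-Baer $*$-ring. *)

theory Defs
  imports Main
begin

text \<open>
  The ring is a type of class \<^class>\<open>ring\<close>, which does not include an identity element.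
\<close>

locale star_ring =
  fixes star :: "'a::ring \<Rightarrow> 'a"
  assumes star_add: "star (x + y) = star x + star y"
    and star_mult: "star (x * y) = star y * star x"
    and star_star: "star (star x) = x"
begin

definition projection :: "'a \<Rightarrow> bool" where
  "projection e \<longleftrightarrow> e = e * e \<and> e = star e"

end

definition right_multiples :: "'a::ring \<Rightarrow> 'a set" where
  "right_multiples a = range (\<lambda>r. a * r)"

definition right_annihilator :: "'a::ring set \<Rightarrow> 'a set" where
  "right_annihilator B = {x. \<forall>b\<in>B. b * x = 0}"

locale pq_Baer_star_ring = star_ring +
  assumes right_annihilator_principal:
    "\<exists>e. projection e \<and> right_annihilator (right_multiples a) = right_multiples e"

definition conrad_le :: "'a::ring \<Rightarrow> 'a \<Rightarrow> bool" where
  "conrad_le a b \<longleftrightarrow> (\<forall>r. a * r * b = a * r * a)"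

end

theory Submission
  imports Defs
begin

text \<open>
  The Conrad order is two-sided because the ring is semiprime: \<open>a R (c - a) = 0\<close> forces
  \<open>(c - a) R a = 0\<close>. Hence, for all \<open>r\<close> and \<open>s\<close>, the element \<open>c r a s b\<close> equals both
  \<open>a r a s b\<close> and \<open>b r a s b\<close>, so it lies in \<open>a R \<inter> b R = {0}\<close>. From \<open>b R a R b = 0\<close>
  semiprimeness gives \<open>a R b = 0 = b R a\<close>, so the cross terms in \<open>(a + b) r (a + b)\<close> vanish.
\<close>

lemma mem_right_multiples: "a * r \<in> right_multiples a"
  by (simp add: right_multiples_def)

context pq_Baer_star_ring
begin

text \<open>The annihilator of \<open>0 R\<close> is the whole ring, so its projection is a left identity.\<close>

lemma identity_exists: "\<exists>u::'a. \<forall>x. u * x = x \<and> x * u = x"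
proof -
  obtain u where u: "projection u"
    and ann: "right_annihilator (right_multiples 0) = right_multiples u"
    using right_annihilator_principal by blast
  have uu: "u * u = u" and su: "star u = u"
    using u unfolding projection_def by simp_all
  have left: "u * x = x" for x
  proof -
    have "x \<in> right_multiples u"
      unfolding ann[symmetric] by (auto simp: right_annihilator_def right_multiples_def)
    then obtain y where "x = u * y" by (auto simp: right_multiples_def)
    then show ?thesis using uu by (metis mult.assoc)
  qed
  moreover have "x * u = x" for x
    \<comment> \<open>Applying \<open>star\<close> to \<open>u * star x = star x\<close> turns the
      left identity into a right one.\<close>
    using left[of "star x"] by (metis star_mult su star_star)
  ultimately show ?thesis by blast
qed

text \<open>
  The annihilator \<open>e R\<close> of \<open>x R\<close> is a two-sided ideal, which together with the involution
  makes \<open>e\<close> central; so \<open>x \<in> e R\<close> gives \<open>x = e x = x e = 0\<close>.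
\<close>

lemma semiprime:
  fixes x :: 'a
  assumes "\<And>r. x * r * x = 0"
  shows "x = 0"
proof -
  obtain u :: 'a where u: "\<And>y. u * y = y" "\<And>y. y * u = y"
    using identity_exists by blast
  obtain e where e: "projection e"
    and ann: "right_annihilator (right_multiples x) = right_multiples e"
    using right_annihilator_principal by blast
  have ee: "e * e = e" and se: "star e = e"
    using e unfolding projection_def by simp_all
  have annI: "y \<in> right_multiples e" if "\<And>r. x * r * y = 0" for y
    unfolding ann[symmetric] using that by (auto simp: right_annihilator_def right_multiples_def)
  have fixed: "e * y = y" if y: "y \<in> right_multiples e" for y
    using y ee by (auto simp: right_multiples_def mult.assoc[symmetric])
  have "e \<in> right_annihilator (right_multiples x)"
    unfolding ann using mem_right_multiples[of e e] ee by simp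
  then have xe: "x * r * e = 0" for r
    by (auto simp: right_annihilator_def right_multiples_def)
  have ideal: "e * (r * e) = r * e" for r
    by (rule fixed, rule annI) (metis xe mult.assoc)
  \<comment> \<open>Both sides equal \<open>e * r * e\<close>: one by \<open>ideal\<close> at
    \<open>r\<close>, the other by applying \<open>star\<close> to \<open>ideal\<close> at
    \<open>star r\<close>.\<close>
  have central: "e * r = r * e" for r
    using ideal[of r] arg_cong[OF ideal[of "star r"], of star]
    by (simp add: star_mult star_star se mult.assoc)
  have "x = e * x" using fixed annI assms by simp
  also have "\<dots> = x * e" by (rule central)
  also have "\<dots> = 0" using xe[of u] u by simp
  finally show ?thesis .
qed

lemma conrad_le_left:
  fixes a c :: 'a
  assumes "conrad_le a c"
  shows "c * r * a = a * r * a"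
proof -
  have ann: "a * s * (c - a) = 0" for s
    using assms by (simp add: conrad_le_def right_diff_distrib)
  have "(c - a) * r * a = 0"
  proof (rule semiprime)
    fix s
    \<comment> \<open>Regrouping exposes the vanishing inner factor
      \<open>a * s * (c - a)\<close>.\<close>
    have "(c - a) * r * a * s * ((c - a) * r * a) = (c - a) * r * (a * s * (c - a)) * r * a"
      by (simp add: mult.assoc)
    then show "(c - a) * r * a * s * ((c - a) * r * a) = 0"
      by (simp add: ann)
  qed
  then show ?thesis by (simp add: left_diff_distrib)
qed

lemma orthogonal_if_common_upper_bound:
  fixes a b c :: 'a
  assumes "conrad_le a c" and "conrad_le b c"
    and "right_multiples a \<inter> right_multiples b = {0}"
  shows "a * r * b = 0" and "b * r * a = 0"
proof -
  have bab: "b * s * a * t * b = 0" for s t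
  proof -
    have "a * s * a * t * b = c * s * a * t * b"
      by (simp add: conrad_le_left[OF assms(1)])
    also have "\<dots> = b * s * a * t * b"
      using conrad_le_left[OF assms(2), of "s * a * t"] by (simp add: mult.assoc)
    finally have eq: "a * s * a * t * b = b * s * a * t * b" .
    \<comment> \<open>By \<open>eq\<close> this element also has a form with leading factor
      \<open>a\<close>.\<close>
    have "b * s * a * t * b \<in> right_multiples a"
      unfolding eq[symmetric] by (simp add: mult.assoc mem_right_multiples)
    moreover have "b * s * a * t * b \<in> right_multiples b"
      by (simp add: mult.assoc mem_right_multiples)
    ultimately show ?thesis using assms(3) by blast
  qed
  show "a * r * b = 0"
  proof (rule semiprime)
    fix s
    have "a * r * b * s * (a * r * b) = a * r * (b * s * a * r * b)"
      by (simp add: mult.assoc)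
    then show "a * r * b * s * (a * r * b) = 0" by (simp add: bab)
  qed
  show "b * r * a = 0"
  proof (rule semiprime)
    fix s
    have "b * r * a * s * (b * r * a) = (b * r * a * s * b) * r * a"
      by (simp add: mult.assoc)
    then show "b * r * a * s * (b * r * a) = 0" by (simp add: bab)
  qed
qed

end

theorem theorem3p11:
  fixes star :: "'a::ring \<Rightarrow> 'a" and a b c :: 'a
  assumes "pq_Baer_star_ring star"
    and "conrad_le a c" and "conrad_le b c"
    and "right_multiples a \<inter> right_multiples b = {0}"
  shows "conrad_le (a + b) c"
  using assms(2,3) pq_Baer_star_ring.orthogonal_if_common_upper_bound[OF assms]
  by (simp add: conrad_le_def distrib_left distrib_right)

end
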